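(* Let $G$ be a graph with ${\rm diam}(G)=3$ and let $\mathcal{I}$ be the set of all maximal independent sets of $G$. Then $\chi_{\rho}(G)=|V(G)|-m'(G)+2$, where $$m'(G)=\max_{A\in\mathcal{I}}\{|A|+\omega(D(G)-A)\}.$$
   Context: Graphs are finite and simple; $d(u,v)$ is the distance in $G$. A packing $k$-coloring is a map $c:V(G)\to\{1,\dots,k\}$ such that $c(u)=c(v)=i$, $u\ne v$, implies $d(u,v)>i$; the packing chromatic number $\chi_{\rho}(G)$ is the smallest $k$ for which a packing $k$-coloring exists. The diametrical graph $D(G)$ has vertex set $V(G)$, with $x,y$ adjacent iff $d(x,y)={\rm diam}(G)$; $D(G)-A$ is obtained by deleting the vertices of $A$. $\omega(H)$ is the clique number (maximum size of a clique) of $H$. *)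

theory Defs
  imports "Graph_Theory.Graph_Theory"
begin

(* Finite simple graphs are the locale \<open>graph\<close>: finite symmetric digraphs without loops and
   without parallel arcs. An undirected edge is the pair of its two opposite arcs. *)

text \<open>Unit weights turn the shortest path cost into the number of edges of a shortest walk;
  vertices in different components are at distance \<open>\<infinity>\<close>.\<close>

definition gdist :: "('a, 'b) pre_digraph \<Rightarrow> 'a \<Rightarrow> 'a \<Rightarrow> ereal" where
  "gdist G u v = wf_digraph.\<mu> G (\<lambda>_. 1) u v"

definition diam :: "('a, 'b) pre_digraph \<Rightarrow> ereal" where
  "diam G = (SUP u\<in>verts G. SUP v\<in>verts G. gdist G u v)"

definition packing_coloring :: "('a, 'b) pre_digraph \<Rightarrow> nat \<Rightarrow> ('a \<Rightarrow> nat) \<Rightarrow> bool" where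
  "packing_coloring G k c \<longleftrightarrow>
    c ` verts G \<subseteq> {1..k} \<and>
    (\<forall>u\<in>verts G. \<forall>v\<in>verts G. \<forall>i. c u = i \<and> c v = i \<and> u \<noteq> v \<longrightarrow> gdist G u v > ereal (real i))"

definition packing_chromatic_number :: "('a, 'b) pre_digraph \<Rightarrow> nat" where
  "packing_chromatic_number G = (LEAST k. \<exists>c. packing_coloring G k c)"

text \<open>The condition \<open>x \<noteq> y\<close> matters only for diameter 0, where it prevents a loop.\<close>

definition diametrical_graph :: "('a, 'b) pre_digraph \<Rightarrow> ('a, 'a \<times> 'a) pre_digraph" where
  "diametrical_graph G = with_proj
    \<lparr> pverts = verts G,
      parcs = {(x, y). x \<in> verts G \<and> y \<in> verts G \<and> x \<noteq> y \<and> gdist G x y = diam G} \<rparr>"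

definition del_verts :: "('a, 'b) pre_digraph \<Rightarrow> 'a set \<Rightarrow> ('a, 'b) pre_digraph" where
  "del_verts H A = H \<restriction> (verts H - A)"

definition independent_set :: "('a, 'b) pre_digraph \<Rightarrow> 'a set \<Rightarrow> bool" where
  "independent_set G A \<longleftrightarrow> A \<subseteq> verts G \<and> (\<forall>u\<in>A. \<forall>v\<in>A. \<not> u \<rightarrow>\<^bsub>G\<^esub> v)"

definition maximal_independent_sets :: "('a, 'b) pre_digraph \<Rightarrow> 'a set set" where
  "maximal_independent_sets G =
    {A. independent_set G A \<and> (\<forall>B. independent_set G B \<and> A \<subseteq> B \<longrightarrow> B = A)}"

definition is_clique :: "('a, 'b) pre_digraph \<Rightarrow> 'a set \<Rightarrow> bool" where
  "is_clique H K \<longleftrightarrow> K \<subseteq> verts H \<and> (\<forall>u\<in>K. \<forall>v\<in>K. u \<noteq> v \<longrightarrow> u \<rightarrow>\<^bsub>H\<^esub> v)"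

definition clique_number :: "('a, 'b) pre_digraph \<Rightarrow> nat" where
  "clique_number H = Max (card ` {K. is_clique H K})"

definition m' :: "('a, 'b) pre_digraph \<Rightarrow> nat" where
  "m' G = Max ((\<lambda>A. card A + clique_number (del_verts (diametrical_graph G) A))
                 ` maximal_independent_sets G)"

end

theory Submission
  imports Defs
begin

text \<open>
  In a graph of diameter 3, a class of color 1 is an independent set, a class of color 2 is a
  clique of the diametrical graph, and every color above 2 is used at most once. A packing coloring
  is therefore cheapest when the first two classes cover as many vertices as possible; enlarging the
  first class to a maximal independent set, at the expense of the second, does not lose any of the
  covered vertices.
\<close>

text \<open>Unfolds the pair-digraph encoding once, so that all later work on second color classes
  is about distances only.\<close>

lemma is_clique_del_verts_diametrical_graph:
  "is_clique (del_verts (diametrical_graph G) A) K \<longleftrightarrow>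
    K \<subseteq> verts G - A \<and> pairwise (\<lambda>x y. gdist G x y = diam G) K"
  by (auto simp: is_clique_def del_verts_def diametrical_graph_def pairwise_def arcs_ends_def
      arc_to_ends_def subset_iff)

section \<open>Distances as infima of walk lengths\<close>

context wf_digraph
begin

lemma awalk_cost_unit: "awalk_cost (\<lambda>_. 1) p = real (length p)"
  by (induction p) auto

lemma gdist_le_length: "awalk u p v \<Longrightarrow> gdist G u v \<le> ereal (real (length p))"
  using min_cost_le_walk_cost[of u p v "\<lambda>_. 1"] by (simp add: gdist_def awalk_cost_unit)

lemma gdist_greatest:
  "(\<And>p. awalk u p v \<Longrightarrow> x \<le> ereal (real (length p))) \<Longrightarrow> x \<le> gdist G u v"
  unfolding gdist_def \<mu>_def by (rule INF_greatest) (simp add: awalk_cost_unit)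

text \<open>Every walk length is a natural number above \<open>n\<close>, and the bound passes to
  the infimum, infinite distance included. It lifts "more than 2" to the diameter 3.\<close>

lemma gdist_greater_imp_Suc_le:
  assumes "ereal (real n) < gdist G u v"
  shows "ereal (real (Suc n)) \<le> gdist G u v"
proof (rule gdist_greatest)
  fix p
  assume "awalk u p v"
  then have "ereal (real n) < ereal (real (length p))"
    using assms gdist_le_length by (metis less_le_trans)
  then show "ereal (real (Suc n)) \<le> ereal (real (length p))"
    by simp
qed

text \<open>Identifies the condition on color 1 with independence.\<close>

lemma one_less_gdist_iff:
  assumes "u \<noteq> v"
  shows "1 < gdist G u v \<longleftrightarrow> \<not> u \<rightarrow>\<^bsub>G\<^esub> v"
proof
  assume less: "1 < gdist G u v"
  show "\<not> u \<rightarrow>\<^bsub>G\<^esub> v"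
  proof
    assume "u \<rightarrow>\<^bsub>G\<^esub> v"
    then obtain e where "e \<in> arcs G" "tail G e = u" "head G e = v"
      by auto
    then have "awalk u [e] v"
      using arc_implies_awalk by auto
    then show False
      using gdist_le_length[of u "[e]" v] less by (simp flip: one_ereal_def)
  qed
next
  assume nadj: "\<not> u \<rightarrow>\<^bsub>G\<^esub> v"
  \<comment> \<open>An infimum preserves only non-strict bounds, so each walk is bounded by 2: the
    empty walk would force \<open>u = v\<close>, a single arc would make them adjacent.\<close>
  have "ereal 2 \<le> gdist G u v"
  proof (rule gdist_greatest)
    fix p
    assume walk: "awalk u p v"
    have "2 \<le> length p"
    proof (rule ccontr)
      assume "\<not> 2 \<le> length p"
      then consider "p = []" | e where "p = [e]"
        by (cases p; cases "tl p") auto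
      then show False
        using walk nadj assms
        by cases (auto simp: awalk_simps dest: in_arcs_imp_in_arcs_ends)
    qed
    then show "ereal 2 \<le> ereal (real (length p))"
      by simp
  qed
  moreover have "1 < ereal 2"
    by simp
  ultimately show "1 < gdist G u v"
    by (rule less_le_trans[rotated])
qed

lemma gdist_le_diam:
  "u \<in> verts G \<Longrightarrow> v \<in> verts G \<Longrightarrow> gdist G u v \<le> diam G"
  unfolding diam_def by (meson SUP_upper2 order_refl)

text \<open>A pair at positive finite distance is joined by a nonempty walk, whose first arc serves.
  This will rule out colorings with fewer than two colors.\<close>

lemma exists_arc_if_diam_finite_pos:
  assumes "0 < diam G" "diam G < \<infinity>"
  obtains u v where "u \<rightarrow>\<^bsub>G\<^esub> v"
proof -
  obtain u v where uv: "u \<in> verts G" "v \<in> verts G" "0 < gdist G u v"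
    using assms(1) by (auto simp: diam_def less_SUP_iff)
  have "gdist G u v \<noteq> \<infinity>"
    using gdist_le_diam[OF uv(1,2)] assms(2) by auto
  then have "u \<rightarrow>\<^sup>*\<^bsub>G\<^esub> v"
    using shortest_path_inf by (auto simp: gdist_def)
  then obtain p where p: "awalk u p v"
    by (auto simp: reachable_awalk)
  with uv(3) have "p \<noteq> []"
    using gdist_le_length[OF p] by (auto simp flip: zero_ereal_def)
  then obtain e q where "p = e # q"
    by (cases p) auto
  with p have "tail G e \<rightarrow>\<^bsub>G\<^esub> head G e"
    by (auto simp: awalk_Cons_iff intro: in_arcs_imp_in_arcs_ends)
  then show thesis
    by (rule that)
qed

end

section \<open>The maximum \<open>m'\<close> over finite families\<close>

context fin_digraph
begin

lemma finite_cliques_diametrical_graph: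
  "finite {K. is_clique (del_verts (diametrical_graph G) A) K}"
  by (rule finite_subset[of _ "Pow (verts G)"]) (auto simp: is_clique_del_verts_diametrical_graph)

lemma finite_maximal_independent_sets: "finite (maximal_independent_sets G)"
  by (rule finite_subset[of _ "Pow (verts G)"])
    (auto simp: maximal_independent_sets_def independent_set_def)

lemma independent_set_extend:
  assumes "independent_set G A"
  obtains B where "B \<in> maximal_independent_sets G" "A \<subseteq> B"
proof -
  have "finite {B. independent_set G B}"
    by (rule finite_subset[of _ "Pow (verts G)"]) (auto simp: independent_set_def)
  then obtain B where "independent_set G B" "A \<subseteq> B"
    "\<And>C. independent_set G C \<Longrightarrow> B \<subseteq> C \<Longrightarrow> C = B"
    using finite_has_maximal2[of "{B. independent_set G B}" A] assms by auto
  then show thesis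
    using that[of B] unfolding maximal_independent_sets_def by blast
qed

lemma card_le_m':
  assumes "A \<in> maximal_independent_sets G"
    and "is_clique (del_verts (diametrical_graph G) A) K"
  shows "card A + card K \<le> m' G"
proof -
  have "card K \<le> clique_number (del_verts (diametrical_graph G) A)"
    unfolding clique_number_def using assms(2) finite_cliques_diametrical_graph by (intro Max_ge) auto
  moreover have "card A + clique_number (del_verts (diametrical_graph G) A) \<le> m' G"
    unfolding m'_def using assms(1) finite_maximal_independent_sets by (intro Max_ge) auto
  ultimately show ?thesis
    by linarith
qed

text \<open>Both maxima range over finite nonempty sets: the empty set extends to a maximal
  independent set, and it is a clique.\<close>

lemma m'_attained:
  obtains A K where "A \<in> maximal_independent_sets G"
    "is_clique (del_verts (diametrical_graph G) A) K" "m' G = card A + card K"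
proof -
  let ?w = "\<lambda>A. clique_number (del_verts (diametrical_graph G) A)"
  have "maximal_independent_sets G \<noteq> {}"
    using independent_set_extend[of "{}"] by (auto simp: independent_set_def)
  then have "m' G \<in> (\<lambda>A. card A + ?w A) ` maximal_independent_sets G"
    unfolding m'_def using finite_maximal_independent_sets by (intro Max_in) auto
  then obtain A where A: "A \<in> maximal_independent_sets G" "m' G = card A + ?w A"
    by auto
  have "is_clique (del_verts (diametrical_graph G) A) {}"
    by (simp add: is_clique_def)
  then have "?w A \<in> card ` {K. is_clique (del_verts (diametrical_graph G) A) K}"
    unfolding clique_number_def using finite_cliques_diametrical_graph by (intro Max_in) auto
  then show thesis
    using that A by auto
qed

end

section \<open>Lower bound on the number of colors\<close>

lemma (in digraph) card_verts_le_packing_coloring: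
  assumes diam: "diam G = 3" and c: "packing_coloring G k c"
  shows "card (verts G) + 2 \<le> m' G + k"
proof -
  have range: "1 \<le> c u" "c u \<le> k" if "u \<in> verts G" for u
    using c that by (auto simp: packing_coloring_def)
  have far: "ereal (real (c u)) < gdist G u v"
    if "u \<in> verts G" "v \<in> verts G" "c u = c v" "u \<noteq> v" for u v
    using c that by (auto simp: packing_coloring_def)
  have le3: "gdist G u v \<le> ereal 3" if "u \<in> verts G" "v \<in> verts G" for u v
    using gdist_le_diam[OF that] diam by simp
  define A where "A = {u \<in> verts G. c u = 1}"
  define K where "K = {u \<in> verts G. c u = 2}"
  define R where "R = verts G - (A \<union> K)"
  have nadj: "\<not> u \<rightarrow>\<^bsub>G\<^esub> v" if "u \<in> A" "v \<in> A" for u v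
  proof (cases "u = v")
    case True
    then show ?thesis
      using no_loops by (auto simp: arcs_ends_conv)
  next
    case False
    then show ?thesis
      using far[of u v] that one_less_gdist_iff[of u v] by (auto simp: A_def one_ereal_def)
  qed
  then have "independent_set G A"
    by (auto simp: independent_set_def A_def)
  then obtain B where B: "B \<in> maximal_independent_sets G" "A \<subseteq> B"
    by (rule independent_set_extend)
  then have "B \<subseteq> verts G"
    by (auto simp: maximal_independent_sets_def independent_set_def)
  then have finB: "finite B"
    using finite_verts finite_subset by blast
  have finK: "finite K"
    by (simp add: K_def)
  have "gdist G u v = diam G" if "u \<in> K" "v \<in> K" "u \<noteq> v" for u v
  proof (rule antisym)
    have uv: "u \<in> verts G" "v \<in> verts G" "c u = 2" "c v = 2"
      using that by (auto simp: K_def)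
    then show "gdist G u v \<le> diam G"
      by (simp add: gdist_le_diam)
    \<comment> \<open>Color 2 demands distance above 2, hence at least 3, which is the
      diameter.\<close>
    show "diam G \<le> gdist G u v"
      using gdist_greater_imp_Suc_le[of 2 u v] far[of u v] uv that diam by simp
  qed
  \<comment> \<open>Removing \<open>B\<close> keeps a clique and makes it avoid the deleted
    vertices.\<close>
  then have "is_clique (del_verts (diametrical_graph G) B) (K - B)"
    by (auto simp: is_clique_del_verts_diametrical_graph pairwise_def K_def)
  then have m': "card B + card (K - B) \<le> m' G"
    by (rule card_le_m'[OF B(1)])
  \<comment> \<open>A repeated color of at least 3 would need a distance above the diameter.\<close>
  have "inj_on c R"
  proof (rule inj_onI, rule ccontr)
    fix u v
    assume uv: "u \<in> R" "v \<in> R" "c u = c v" "u \<noteq> v"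
    then have "3 \<le> c u"
      using range[of u] by (auto simp: R_def A_def K_def)
    moreover have "ereal (real (c u)) < ereal 3"
      using uv less_le_trans[OF far[of u v] le3[of u v]] by (auto simp: R_def)
    ultimately show False
      by simp
  qed
  moreover have "c ` R \<subseteq> {3..k}"
  proof
    fix i
    assume "i \<in> c ` R"
    then obtain u where "u \<in> verts G" "c u \<noteq> 1" "c u \<noteq> 2" "i = c u"
      by (auto simp: R_def A_def K_def)
    then show "i \<in> {3..k}"
      using range[of u] by auto
  qed
  ultimately have "card R \<le> k - 2"
    using card_inj_on_le[of c R "{3..k}"] by simp
  \<comment> \<open>Without this, \<open>k - 2\<close> would truncate to 0 and the bound on
    \<open>card R\<close> would not give \<open>card R + 2 \<le> k\<close>. With fewer than two
    colors all of \<open>verts G\<close> would be independent, yet an arc exists.\<close>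
  moreover have "2 \<le> k"
  proof (rule ccontr)
    assume "\<not> 2 \<le> k"
    then have "A = verts G"
      using range by (force simp: A_def)
    obtain u v where "u \<rightarrow>\<^bsub>G\<^esub> v"
      using exists_arc_if_diam_finite_pos diam by auto
    then show False
      using nadj[of u v] \<open>A = verts G\<close> by (auto dest: adj_in_verts)
  qed
  moreover have "card (verts G) \<le> card B + card (K - B) + card R"
  proof -
    \<comment> \<open>Vertices of \<open>K\<close> that leave the clique lie in \<open>B\<close>, so
      they are still covered.\<close>
    have "verts G \<subseteq> (B \<union> (K - B)) \<union> R"
      using B(2) by (auto simp: R_def)
    then have "card (verts G) \<le> card ((B \<union> (K - B)) \<union> R)"
      using finB finK by (intro card_mono) (auto simp: R_def)
    also have "\<dots> \<le> card B + card (K - B) + card R"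
      by (meson add_le_mono card_Un_le order_refl order_trans)
    finally show ?thesis .
  qed
  ultimately show ?thesis
    using m' by linarith
qed

section \<open>Construction of an optimal coloring\<close>

lemma (in fin_digraph) packing_coloring_if_independent_clique:
  assumes diam: "diam G = 3" and A: "independent_set G A"
    and K: "is_clique (del_verts (diametrical_graph G) A) K"
  shows "\<exists>c. packing_coloring G (card (verts G) - (card A + card K) + 2) c"
proof -
  define R where "R = verts G - (A \<union> K)"
  have AV: "A \<subseteq> verts G" and nadj: "\<And>u v. u \<in> A \<Longrightarrow> v \<in> A \<Longrightarrow> \<not> u \<rightarrow>\<^bsub>G\<^esub> v"
    using A by (auto simp: independent_set_def)
  have KV: "K \<subseteq> verts G" "K \<inter> A = {}"
    and gdist3: "\<And>u v. u \<in> K \<Longrightarrow> v \<in> K \<Longrightarrow> u \<noteq> v \<Longrightarrow> gdist G u v = 3"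
    using K diam by (auto simp: is_clique_del_verts_diametrical_graph pairwise_def)
  have fin: "finite A" "finite K"
    using AV KV finite_verts finite_subset by blast+
  have "card R = card (verts G) - card (A \<union> K)"
    unfolding R_def using AV KV fin by (intro card_Diff_subset) auto
  also have "card (A \<union> K) = card A + card K"
    using fin KV by (intro card_Un_disjoint) auto
  finally have cardR: "card R = card (verts G) - (card A + card K)" .
  obtain f where f: "bij_betw f R {0..<card R}"
    using ex_bij_betw_finite_nat[of R] by (auto simp: R_def)
  \<comment> \<open>The enumeration \<open>f\<close> starts at 0, so adding 3 gives the vertices of
    \<open>R\<close> exactly the colors from 3 to \<open>card R + 2\<close>.\<close>
  define c where "c u = (if u \<in> A then 1 else if u \<in> K then 2 else f u + 3)" for u
  have fR: "f u < card R" if "u \<in> R" for u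
    using f that by (auto simp: bij_betw_def)
  have "packing_coloring G (card R + 2) c"
    unfolding packing_coloring_def
  proof (intro conjI ballI allI impI)
    show "c ` verts G \<subseteq> {1..card R + 2}"
    proof
      fix i
      assume "i \<in> c ` verts G"
      then obtain u where "u \<in> verts G" "i = c u"
        by auto
      then show "i \<in> {1..card R + 2}"
        using fR[of u] by (cases "u \<in> R") (auto simp: c_def R_def)
    qed
  next
    fix u v i
    assume uv: "u \<in> verts G" "v \<in> verts G" and "c u = i \<and> c v = i \<and> u \<noteq> v"
    then have c: "c u = i" "c v = i" and ne: "u \<noteq> v"
      by auto
    consider "u \<in> A" | "u \<in> K" "u \<notin> A" | "u \<in> R"
      using uv by (auto simp: R_def)
    then show "ereal (real i) < gdist G u v"
    proof cases
      case 1
      then have "i = 1" "v \<in> A"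
        using c by (auto simp: c_def split: if_splits)
      then show ?thesis
        using one_less_gdist_iff[OF ne] nadj 1 by (simp add: one_ereal_def)
    next
      case 2
      then have "i = 2" "v \<in> K"
        using c by (auto simp: c_def split: if_splits)
      then show ?thesis
        using gdist3 2 ne by simp
    next
      \<comment> \<open>Vacuous: distinct vertices of \<open>R\<close> get distinct colors, all
        different from 1 and 2.\<close>
      case 3
      then have "v \<in> R" "f u = f v"
        using c uv by (auto simp: c_def R_def split: if_splits)
      then show ?thesis
        using 3 ne f by (auto simp: bij_betw_def dest: inj_onD)
    qed
  qed
  then show ?thesis
    unfolding cardR by blast
qed

theorem theorem16:
  fixes G :: "('a, 'b) pre_digraph"
  assumes "graph G"
    and "diam G = 3"
  shows "int (packing_chromatic_number G) = int (card (verts G)) - int (m' G) + 2"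
proof -
  interpret graph G
    by fact
  obtain A K where A: "A \<in> maximal_independent_sets G"
    and K: "is_clique (del_verts (diametrical_graph G) A) K" and m': "m' G = card A + card K"
    by (rule m'_attained)
  have ind: "independent_set G A"
    using A by (simp add: maximal_independent_sets_def)
  have sub: "A \<subseteq> verts G" "K \<subseteq> verts G - A"
    using ind K by (auto simp: independent_set_def is_clique_del_verts_diametrical_graph)
  \<comment> \<open>\<open>A\<close> and \<open>K\<close> are disjoint sets of vertices. The
    resulting bound on \<open>m' G\<close> makes the natural-number subtraction below agree with the
    integer one in the claim.\<close>
  then have "card K \<le> card (verts G) - card A"
    by (metis card_Diff_subset card_mono finite_Diff finite_subset finite_verts)
  then have "m' G \<le> card (verts G)"
    using m' sub card_mono[OF finite_verts sub(1)] by linarith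
  moreover have "packing_chromatic_number G = card (verts G) - m' G + 2"
    unfolding packing_chromatic_number_def
  proof (rule Least_equality)
    show "\<exists>c. packing_coloring G (card (verts G) - m' G + 2) c"
      using packing_coloring_if_independent_clique[OF assms(2) ind K] m' by simp
  next
    fix k
    assume "\<exists>c. packing_coloring G k c"
    then obtain c where "packing_coloring G k c"
      by blast
    then have "card (verts G) + 2 \<le> m' G + k"
      by (rule card_verts_le_packing_coloring[OF assms(2)])
    then show "card (verts G) - m' G + 2 \<le> k"
      using \<open>m' G \<le> card (verts G)\<close> by linarith
  qed
  ultimately show ?thesis
    by simp
qed

end
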